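(* Let $0<\alpha<1$ and $T>0$. For any function $v\in C^3[0,T]$ one has $$\partial_{0t_{j+1}}^{\alpha}v=\Delta_{0t_{j+1}}^{\alpha}v+O(\tau^{2-\alpha}),$$ that is, there is a constant $C$ (depending on $v,\alpha,T$ but not on $\tau$ or $j$) such that for every uniform time grid $t_n=n\tau$, $n=0,\dots,N_t$, $\tau=T/N_t$, and every $j=0,1,\dots,N_t-1$, $$\left|\partial_{0t_{j+1}}^{\alpha}v-\Delta_{0t_{j+1}}^{\alpha}v\right|\le C\tau^{2-\alpha}.$$
   Context: The Caputo fractional derivative of order $\alpha\in(0,1)$ is $$\partial_{0t}^{\alpha}v=\frac{1}{\Gamma(1-\alpha)}\int_0^t\frac{v'(\eta)}{(t-\eta)^{\alpha}}\,d\eta .$$ Its difference analogue on the grid $t_n=n\tau$ is $$\Delta_{0t_{j+1}}^{\alpha}v=\frac{1}{\Gamma(2-\alpha)}\sum_{s=0}^{j}\left(t_{j-s+1}^{1-\alpha}-t_{j-s}^{1-\alpha}\right)\frac{v(t_{s+1})-v(t_s)}{\tau}.$$ *)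

theory Defs
  imports "HOL-Analysis.Analysis"
begin

text \<open>\<open>k\<close>-times continuously differentiable functions on a set; \<open>D i\<close> is the \<open>i\<close>-th derivative.
  Derivatives are taken within \<open>S\<close>, hence are one-sided at the endpoints of an interval.\<close>

definition Ck_on :: "nat \<Rightarrow> (real \<Rightarrow> real) \<Rightarrow> real set \<Rightarrow> bool" where
  "Ck_on k f S \<longleftrightarrow>
     (\<exists>D :: nat \<Rightarrow> real \<Rightarrow> real.
        (\<forall>x\<in>S. D 0 x = f x) \<and>
        (\<forall>i<k. \<forall>x\<in>S. (D i has_real_derivative D (Suc i) x) (at x within S)) \<and>
        continuous_on S (D k))"

text \<open>For \<open>v\<close> in \<open>C\<^sup>1[0,T]\<close> and \<open>0 < t \<le> T\<close>, \<^const>\<open>deriv\<close> is the derivative of \<open>v\<close> on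
  the open interval \<open>(0,t)\<close>; the (arbitrary) values of the integrand at the two endpoints do
  not affect the integral.\<close>

definition caputo :: "real \<Rightarrow> (real \<Rightarrow> real) \<Rightarrow> real \<Rightarrow> real" where
  "caputo \<alpha> v t =
     1 / Gamma (1 - \<alpha>) * integral {0..t} (\<lambda>\<eta>. deriv v \<eta> / (t - \<eta>) powr \<alpha>)"

definition grid :: "real \<Rightarrow> nat \<Rightarrow> real" where
  "grid \<tau> n = real n * \<tau>"

text \<open>The difference analogue at the grid point with index \<open>j + 1\<close>. Note that
  \<open>0 powr (1 - \<alpha>) = 0\<close>, as the term \<open>s = j\<close> requires for \<open>\<alpha> < 1\<close>.\<close>

definition caputo_diff :: "real \<Rightarrow> real \<Rightarrow> (real \<Rightarrow> real) \<Rightarrow> nat \<Rightarrow> real" where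
  "caputo_diff \<alpha> \<tau> v j =
     1 / Gamma (2 - \<alpha>) *
       (\<Sum>s=0..j. (grid \<tau> (j - s + 1) powr (1 - \<alpha>) - grid \<tau> (j - s) powr (1 - \<alpha>)) *
                 ((v (grid \<tau> (s + 1)) - v (grid \<tau> s)) / \<tau>))"

end

theory Submission
  imports Defs
begin

text \<open>On each cell \<open>[t\<^sub>s, t\<^sub>s\<^sub>+\<^sub>1]\<close> the scheme replaces \<open>v'\<close> by its mean value, which leaves an error
  \<open>e\<close> of mean zero and of size at most \<open>M \<tau>\<close>, where \<open>M\<close> bounds \<open>\<bar>v''\<bar>\<close>. Let \<open>w\<close> be the kernel
  \<open>(t - \<eta>)\<^sup>-\<^sup>\<alpha>\<close> with \<open>t = t\<^sub>j\<^sub>+\<^sub>1\<close>; it is increasing. For \<open>s < j\<close> one may subtract the constant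
  \<open>w(t\<^sub>s)\<close> from \<open>w\<close> without changing the integral of \<open>e w\<close>, so this integral is at most
  \<open>M \<tau>\<^sup>2 (w(t\<^sub>s\<^sub>+\<^sub>1) - w(t\<^sub>s))\<close>, and these bounds telescope to at most \<open>M \<tau>\<^sup>2 \<tau>\<^sup>-\<^sup>\<alpha>\<close>. The singular last
  cell contributes at most \<open>M \<tau>\<close> times the integral of \<open>w\<close>, which is \<open>\<tau>\<^sup>1\<^sup>-\<^sup>\<alpha> / (1 - \<alpha>)\<close>.\<close>

section \<open>Integrals against the weakly singular kernel\<close>

lemma kernel_has_integral:
  fixes a b t \<alpha> :: real
  assumes "\<alpha> < 1" "a \<le> b" "b \<le> t"
  shows "((\<lambda>x. 1 / (t - x) powr \<alpha>) has_integral
            ((t - a) powr (1 - \<alpha>) - (t - b) powr (1 - \<alpha>)) / (1 - \<alpha>)) {a..b}"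
proof -
  let ?F = "\<lambda>x. - ((t - x) powr (1 - \<alpha>)) / (1 - \<alpha>)"
  \<comment> \<open>The case \<open>b = t\<close> is included: since
    \<open>1 - \<alpha> > 0\<close>, the antiderivative \<open>?F\<close> stays continuous up to the
    singularity, and differentiability is needed only in the interior.\<close>
  have "((\<lambda>x. 1 / (t - x) powr \<alpha>) has_integral (?F b - ?F a)) {a..b}"
  proof (rule fundamental_theorem_of_calculus_interior)
    show "continuous_on {a..b} ?F"
      using assms by (intro continuous_intros continuous_on_powr') auto
    fix x assume x: "x \<in> {a<..<b}"
    then have pos: "0 < t - x" using assms by auto
    have "(?F has_real_derivative (t - x) powr (- \<alpha>)) (at x)"
      using pos assms by (auto intro!: derivative_eq_intros)
    then show "(?F has_vector_derivative 1 / (t - x) powr \<alpha>) (at x)"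
      by (simp add: has_real_derivative_iff_has_vector_derivative powr_minus_divide)
  qed (use assms in auto)
  moreover have "?F b - ?F a = ((t - a) powr (1 - \<alpha>) - (t - b) powr (1 - \<alpha>)) / (1 - \<alpha>)"
    by (simp add: diff_divide_distrib)
  ultimately show ?thesis by simp
qed

text \<open>A nonnegative integrable kernel is absolutely integrable, and a continuous factor on a
  compact interval is bounded and measurable.\<close>

lemma kernel_mult_integrable:
  fixes f :: "real \<Rightarrow> real" and a b t \<alpha> :: real
  assumes "\<alpha> < 1" "a \<le> b" "b \<le> t" "continuous_on {a..b} f"
  shows "(\<lambda>x. f x / (t - x) powr \<alpha>) integrable_on {a..b}"
proof -
  have "(\<lambda>x. 1 / (t - x) powr \<alpha>) absolutely_integrable_on {a..b}"
    using kernel_has_integral[OF assms(1-3)]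
    by (intro nonnegative_absolutely_integrable_1) (auto simp: has_integral_integrable)
  moreover have "f \<in> borel_measurable (lebesgue_on {a..b})"
    by (intro continuous_imp_measurable_on_sets_lebesgue assms) auto
  moreover have "bounded (f ` {a..b})"
    by (intro compact_imp_bounded compact_continuous_image assms) auto
  ultimately have "(\<lambda>x. f x * (1 / (t - x) powr \<alpha>)) absolutely_integrable_on {a..b}"
    by (intro absolutely_integrable_bounded_measurable_product_real) auto
  then show ?thesis
    by (simp add: absolutely_integrable_on_def)
qed

section \<open>The error on a single cell\<close>

context
  fixes u u' :: "real \<Rightarrow> real" and a b t \<alpha> M :: real
  assumes \<alpha>: "0 < \<alpha>" "\<alpha> < 1" and ab: "a < b" "b \<le> t"
    and der: "\<And>x. x \<in> {a..b} \<Longrightarrow> (u has_real_derivative u' x) (at x within {a..b})"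
    and lip: "\<And>x y. x \<in> {a..b} \<Longrightarrow> y \<in> {a..b} \<Longrightarrow> \<bar>u' x - u' y\<bar> \<le> M * \<bar>x - y\<bar>"
begin

lemma lipschitz_const_nonneg: "0 \<le> M"
proof -
  have "0 \<le> M * \<bar>a - b\<bar>"
    using lip[of a b] ab by (auto intro: order_trans[OF abs_ge_zero])
  then show ?thesis using ab by (simp add: zero_le_mult_iff)
qed

lemma lipschitz_deriv_continuous_on: "continuous_on {a..b} u'"
proof (rule lipschitz_on_continuous_on)
  show "M-lipschitz_on {a..b} u'"
    using lip lipschitz_const_nonneg by (auto simp: lipschitz_on_def dist_real_def)
qed

text \<open>By the mean value theorem the slope equals \<open>u' z\<close> for some interior
  \<open>z\<close>, which is at most \<open>b - a\<close> away from \<open>x\<close>.\<close>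

lemma deriv_minus_slope_bound:
  assumes x: "x \<in> {a..b}"
  shows "\<bar>u' x - (u b - u a) / (b - a)\<bar> \<le> M * (b - a)"
proof -
  have "\<exists>z\<in>{a<..<b}. u b - u a = (b - a) * u' z"
  proof -
    have "continuous_on {a..b} u"
      using der by (meson DERIV_continuous continuous_on_eq_continuous_within)
    moreover have "(u has_real_derivative u' z) (at z)" if "a < z" "z < b" for z
      using der[of z] that at_within_Icc_at[of a z b] by auto
    ultimately show ?thesis
      using mvt[of a b u "\<lambda>x. (*) (u' x)"] ab
      unfolding has_field_derivative_def by (metis greaterThanLessThan_iff mult.commute)
  qed
  then obtain z where z: "z \<in> {a<..<b}" "(u b - u a) / (b - a) = u' z"
    using ab by (auto simp: field_simps)
  have "M * \<bar>x - z\<bar> \<le> M * (b - a)"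
    using x z lipschitz_const_nonneg by (intro mult_left_mono) auto
  then show ?thesis using lip[of x z] x z by auto
qed

text \<open>Identifies the cell error as the cell's share of the Caputo integral minus its share of
  the difference formula.\<close>

lemma kernel_error_integral:
  "integral {a..b} (\<lambda>x. (u' x - (u b - u a) / (b - a)) / (t - x) powr \<alpha>) =
   integral {a..b} (\<lambda>x. u' x / (t - x) powr \<alpha>) -
   (u b - u a) / (b - a) * (((t - a) powr (1 - \<alpha>) - (t - b) powr (1 - \<alpha>)) / (1 - \<alpha>))"
proof -
  have "((\<lambda>x. u' x / (t - x) powr \<alpha>) has_integral
          integral {a..b} (\<lambda>x. u' x / (t - x) powr \<alpha>)) {a..b}"
    using kernel_mult_integrable[OF \<alpha>(2) _ ab(2) lipschitz_deriv_continuous_on] ab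
    by (auto intro: integrable_integral)
  from has_integral_diff[OF this has_integral_mult_right[OF kernel_has_integral[OF \<alpha>(2) _ ab(2)],
      of a "(u b - u a) / (b - a)"]] ab
  show ?thesis
    by (intro integral_unique) (simp add: diff_divide_distrib)
qed

text \<open>Serves the last cell, where \<open>b = t\<close>: only the size of the error factor is
  used, and the kernel is integrated exactly.\<close>

lemma kernel_error_bound:
  "\<bar>integral {a..b} (\<lambda>x. (u' x - (u b - u a) / (b - a)) / (t - x) powr \<alpha>)\<bar>
     \<le> M * (b - a) * (((t - a) powr (1 - \<alpha>) - (t - b) powr (1 - \<alpha>)) / (1 - \<alpha>))"
proof -
  let ?m = "(u b - u a) / (b - a)"
  note K = has_integral_mult_right[OF kernel_has_integral[OF \<alpha>(2) less_imp_le[OF ab(1)] ab(2)],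
      of "M * (b - a)"]
  have "norm (integral {a..b} (\<lambda>x. (u' x - ?m) / (t - x) powr \<alpha>))
          \<le> integral {a..b} (\<lambda>x. M * (b - a) * (1 / (t - x) powr \<alpha>))"
  proof (rule integral_norm_bound_integral)
    show "(\<lambda>x. (u' x - ?m) / (t - x) powr \<alpha>) integrable_on {a..b}"
      using ab \<alpha> by (intro kernel_mult_integrable continuous_intros lipschitz_deriv_continuous_on) auto
    show "(\<lambda>x. M * (b - a) * (1 / (t - x) powr \<alpha>)) integrable_on {a..b}"
      using K by (rule has_integral_integrable)
    show "norm ((u' x - ?m) / (t - x) powr \<alpha>) \<le> M * (b - a) * (1 / (t - x) powr \<alpha>)"
      if "x \<in> {a..b}" for x
      using deriv_minus_slope_bound[OF that] by (simp add: abs_divide divide_right_mono)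
  qed
  then show ?thesis using integral_unique[OF K] by simp
qed

text \<open>The bound is a kernel increment so that summing over cells telescopes.\<close>

lemma kernel_error_bound_regular:
  assumes bt: "b < t"
  shows "\<bar>integral {a..b} (\<lambda>x. (u' x - (u b - u a) / (b - a)) / (t - x) powr \<alpha>)\<bar>
     \<le> M * (b - a)\<^sup>2 * (1 / (t - b) powr \<alpha> - 1 / (t - a) powr \<alpha>)"
proof -
  let ?m = "(u b - u a) / (b - a)" and ?w = "\<lambda>x. 1 / (t - x) powr \<alpha>"
  have mono: "?w x \<le> ?w y" if "x \<le> y" "y \<le> b" for x y
    using that bt \<alpha> by (intro divide_left_mono powr_mono2) auto
  have "(u' has_integral (u b - u a)) {a..b}"
    using der ab
    by (intro fundamental_theorem_of_calculus)
       (auto simp flip: has_real_derivative_iff_has_vector_derivative)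
  from has_integral_diff[OF this has_integral_const_real[of ?m a b]]
  have mean_zero: "((\<lambda>x. u' x - ?m) has_integral 0) {a..b}"
    using ab by simp
  have "(\<lambda>x. (u' x - ?m) / (t - x) powr \<alpha>) integrable_on {a..b}"
    using ab \<alpha> by (intro kernel_mult_integrable continuous_intros lipschitz_deriv_continuous_on) auto
  \<comment> \<open>The error factor has mean zero, so subtracting the constant \<open>?w a\<close>
    from the kernel leaves the integral unchanged.\<close>
  from has_integral_diff[OF integrable_integral[OF this]
      has_integral_mult_left[OF mean_zero, of "?w a"]]
  have I: "((\<lambda>x. (u' x - ?m) * (?w x - ?w a)) has_integral
          integral {a..b} (\<lambda>x. (u' x - ?m) / (t - x) powr \<alpha>)) {a..b}"
    by (simp add: right_diff_distrib)
  have "norm ((u' x - ?m) * (?w x - ?w a)) \<le> M * (b - a) * (?w b - ?w a)" if x: "x \<in> {a..b}" for x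
  proof -
    have "\<bar>u' x - ?m\<bar> * \<bar>?w x - ?w a\<bar> \<le> M * (b - a) * (?w b - ?w a)"
      using deriv_minus_slope_bound[OF x] mono[of a x] mono[of x b] x lipschitz_const_nonneg ab
      by (intro mult_mono) auto
    then show ?thesis by (simp add: abs_mult)
  qed
  moreover have "0 \<le> M * (b - a) * (?w b - ?w a)"
    using mono[of a b] lipschitz_const_nonneg ab by auto
  \<comment> \<open>The second factor \<open>b - a\<close> is the length of the interval of
    integration.\<close>
  ultimately have "norm (integral {a..b} (\<lambda>x. (u' x - ?m) / (t - x) powr \<alpha>))
      \<le> M * (b - a) * (?w b - ?w a) * (b - a)"
    using has_integral_bound_real[OF _ finite.emptyI I, of "M * (b - a) * (?w b - ?w a)"] ab by simp
  then show ?thesis using ab by (simp add: power2_eq_square mult_ac)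
qed

end

section \<open>Summation over the grid\<close>

lemma integral_sum_grid:
  fixes f :: "real \<Rightarrow> real"
  assumes "0 \<le> \<tau>" "f integrable_on {0..grid \<tau> n}"
  shows "integral {0..grid \<tau> n} f = (\<Sum>s<n. integral {grid \<tau> s..grid \<tau> (s + 1)} f)"
  using assms(2)
proof (induction n)
  case 0
  then show ?case by (simp add: grid_def)
next
  case (Suc n)
  have le: "0 \<le> grid \<tau> n" "grid \<tau> n \<le> grid \<tau> (Suc n)"
    using assms(1) by (auto simp: grid_def mult_right_mono)
  have "f integrable_on {0..grid \<tau> n}"
    by (rule integrable_on_subinterval[OF Suc.prems]) (use le in auto)
  then show ?case
    using Suc.IH Henstock_Kurzweil_Integration.integral_combine[OF le Suc.prems] by simp
qed

text \<open>The one-sided derivative within \<open>{0..T}\<close> agrees with \<open>deriv v\<close>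
  on the open interval; the two endpoints form a null set.\<close>

lemma caputo_eq_integral:
  assumes "0 < t" "t \<le> T"
    and "\<And>x. x \<in> {0..T} \<Longrightarrow> (v has_real_derivative v' x) (at x within {0..T})"
  shows "caputo \<alpha> v t = 1 / Gamma (1 - \<alpha>) * integral {0..t} (\<lambda>x. v' x / (t - x) powr \<alpha>)"
proof -
  have "deriv v x = v' x" if "x \<in> {0..t} - {0, t}" for x
    using assms(3)[of x] that assms(2) at_within_Icc_at[of 0 x T] by (auto intro: DERIV_imp_deriv)
  then have "integral {0..t} (\<lambda>x. deriv v x / (t - x) powr \<alpha>)
      = integral {0..t} (\<lambda>x. v' x / (t - x) powr \<alpha>)"
    by (intro integral_spike[of "{0, t}"]) auto
  then show ?thesis by (simp add: caputo_def)
qed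

text \<open>In the constant, \<open>1\<close> comes from the telescoping sum over the regular cells,
  \<open>1 / (1 - \<alpha>)\<close> from the singular last cell, and
  \<open>1 / Gamma (1 - \<alpha>)\<close> from the prefactor of the Caputo derivative.\<close>

theorem caputo_diff_error:
  fixes v v' :: "real \<Rightarrow> real" and \<alpha> \<tau> T M :: real
  assumes \<alpha>: "0 < \<alpha>" "\<alpha> < 1" and \<tau>: "0 < \<tau>" "grid \<tau> (j + 1) \<le> T"
    and der: "\<And>x. x \<in> {0..T} \<Longrightarrow> (v has_real_derivative v' x) (at x within {0..T})"
    and lip: "\<And>x y. x \<in> {0..T} \<Longrightarrow> y \<in> {0..T} \<Longrightarrow> \<bar>v' x - v' y\<bar> \<le> M * \<bar>x - y\<bar>"
  shows "\<bar>caputo \<alpha> v (grid \<tau> (j + 1)) - caputo_diff \<alpha> \<tau> v j\<bar>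
     \<le> M * (1 + 1 / (1 - \<alpha>)) / Gamma (1 - \<alpha>) * \<tau> powr (2 - \<alpha>)"
proof -
  define t where "t = grid \<tau> (j + 1)"
  define w where "w = (\<lambda>x. 1 / (t - x) powr \<alpha>)"
  define a where "a = (\<lambda>s. grid \<tau> s)"
  define E where "E = (\<lambda>s. integral {a s..a (s + 1)}
     (\<lambda>x. (v' x - (v (a (s + 1)) - v (a s)) / (a (s + 1) - a s)) / (t - x) powr \<alpha>))"
  have t: "0 < t" "t \<le> T" and step: "a (s + 1) - a s = \<tau>" for s
    using \<tau> by (auto simp: t_def a_def grid_def algebra_simps intro: add_pos_nonneg)
  have a_le: "a s \<le> t" if "s \<le> j + 1" for s
    using that \<tau> unfolding a_def t_def grid_def by (intro mult_right_mono) auto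
  have sub: "{a s..a (s + 1)} \<subseteq> {0..T}" if "s \<le> j" for s
    using a_le[of "s + 1"] that t \<tau> by (auto simp: a_def grid_def intro: order_trans[rotated])
  have dist: "t - a s = grid \<tau> (j + 1 - s)" if "s \<le> j + 1" for s
    using that by (simp add: t_def a_def grid_def of_nat_diff algebra_simps)
  have cell_der: "(v has_real_derivative v' x) (at x within {a s..a (s + 1)})"
    if "s \<le> j" "x \<in> {a s..a (s + 1)}" for s x
    using der sub that by (blast intro: has_field_derivative_subset)
  have cell_lip: "\<bar>v' x - v' y\<bar> \<le> M * \<bar>x - y\<bar>"
    if "s \<le> j" "x \<in> {a s..a (s + 1)}" "y \<in> {a s..a (s + 1)}" for s x y
    using lip sub that by blast
  have lt: "a s < a (s + 1)" for s
    using step[of s] \<tau> by simp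

  have M: "0 \<le> M"
    using lipschitz_const_nonneg[OF \<alpha> lt[of 0] a_le[of "0 + 1"] cell_der[of 0] cell_lip[of 0]] by simp
  have last: "\<bar>E j\<bar> \<le> M * (1 / (1 - \<alpha>)) * \<tau> powr (2 - \<alpha>)"
  proof -
    have "\<bar>E j\<bar> \<le> M * (a (j + 1) - a j) *
        (((t - a j) powr (1 - \<alpha>) - (t - a (j + 1)) powr (1 - \<alpha>)) / (1 - \<alpha>))"
      unfolding E_def
      by (rule kernel_error_bound[OF \<alpha> lt[of j] a_le[of "j + 1"] cell_der[of j] cell_lip[of j]]) auto
    \<comment> \<open>Here \<open>t - a j = \<tau>\<close> and \<open>t - a (j + 1) = 0\<close>,
      with \<open>0 powr (1 - \<alpha>) = 0\<close>.\<close>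
    also have "\<dots> = M * (1 / (1 - \<alpha>)) * (\<tau> * \<tau> powr (1 - \<alpha>))"
      using dist[of j] dist[of "j + 1"] step[of j] by (simp add: grid_def)
    also have "\<tau> * \<tau> powr (1 - \<alpha>) = \<tau> powr (2 - \<alpha>)"
      using \<tau> powr_mult_base[of \<tau> "1 - \<alpha>"] by simp
    finally show ?thesis .
  qed
  have regular: "\<bar>E s\<bar> \<le> M * \<tau>\<^sup>2 * (w (a (Suc s)) - w (a s))" if "s < j" for s
  proof -
    have "a (s + 1) < t"
      using that \<tau> by (simp add: a_def t_def grid_def)
    then show ?thesis
      using kernel_error_bound_regular[OF \<alpha> lt[of s] a_le[of "s + 1"] cell_der[of s] cell_lip[of s]]
        that step[of s]
      by (simp add: E_def w_def)
  qed
  have "\<bar>\<Sum>s<j. E s\<bar> \<le> (\<Sum>s<j. M * \<tau>\<^sup>2 * (w (a (Suc s)) - w (a s)))"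
    by (intro order_trans[OF sum_abs] sum_mono regular) auto
  also have "\<dots> = M * \<tau>\<^sup>2 * (w (a j) - w (a 0))"
    using sum_lessThan_telescope[of "\<lambda>s. w (a s)" j] by (simp flip: sum_distrib_left)
  also have "\<dots> \<le> M * \<tau>\<^sup>2 * w (a j)"
    using M by (intro mult_left_mono) (auto simp: w_def)
  \<comment> \<open>The largest remaining kernel value sits one step from the singularity:
    \<open>w (a j) = 1 / \<tau> powr \<alpha>\<close>.\<close>
  also have "\<dots> = M * \<tau> powr (2 - \<alpha>)"
    using \<tau> dist[of j] by (simp add: w_def grid_def powr_diff)
  finally have "\<bar>\<Sum>s<j. E s\<bar> \<le> M * \<tau> powr (2 - \<alpha>)" .
  then have sumE: "\<bar>\<Sum>s<Suc j. E s\<bar> \<le> M * (1 + 1 / (1 - \<alpha>)) * \<tau> powr (2 - \<alpha>)"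
    using last by (simp add: algebra_simps)

  have "continuous_on {0..t} v'"
  proof (rule lipschitz_on_continuous_on)
    show "M-lipschitz_on {0..t} v'"
      using lip t M by (auto simp: lipschitz_on_def dist_real_def)
  qed
  then have "(\<lambda>x. v' x / (t - x) powr \<alpha>) integrable_on {0..t}"
    using \<alpha> t by (intro kernel_mult_integrable) auto
  then have caputo: "caputo \<alpha> v t = 1 / Gamma (1 - \<alpha>) *
      (\<Sum>s<Suc j. integral {a s..a (s + 1)} (\<lambda>x. v' x / (t - x) powr \<alpha>))"
    using caputo_eq_integral[OF t der] integral_sum_grid[of \<tau> _ "Suc j"] \<tau>
    by (simp add: t_def a_def)
  \<comment> \<open>This reconciles the two prefactors: the extra \<open>1 / (1 - \<alpha>)\<close>
    in the scheme is the one produced by integrating the kernel.\<close>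
  have Gamma: "Gamma (2 - \<alpha>) = (1 - \<alpha>) * Gamma (1 - \<alpha>)"
    using Gamma_plus1[of "1 - \<alpha>"] nonpos_Ints_nonpos[of "1 - \<alpha>"] \<alpha> by auto
  have "caputo_diff \<alpha> \<tau> v j = 1 / Gamma (1 - \<alpha>) *
      (\<Sum>s<Suc j. (v (a (s + 1)) - v (a s)) / (a (s + 1) - a s) *
         (((t - a s) powr (1 - \<alpha>) - (t - a (s + 1)) powr (1 - \<alpha>)) / (1 - \<alpha>)))"
    unfolding caputo_diff_def Gamma sum_distrib_left step atLeast0AtMost lessThan_Suc_atMost
  proof (rule sum.cong[OF refl])
    fix s assume "s \<in> {..j}"
    \<comment> \<open>The subtraction \<open>j - s\<close> is on naturals; \<open>s \<le> j\<close>
      keeps it from being truncated.\<close>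
    then have "t - a s = grid \<tau> (j - s + 1)" "t - a (s + 1) = grid \<tau> (j - s)"
      using dist[of s] dist[of "s + 1"] by (auto simp: Suc_diff_le)
    then show "1 / ((1 - \<alpha>) * Gamma (1 - \<alpha>)) * ((grid \<tau> (j - s + 1) powr (1 - \<alpha>) -
          grid \<tau> (j - s) powr (1 - \<alpha>)) * ((v (grid \<tau> (s + 1)) - v (grid \<tau> s)) / \<tau>)) =
        1 / Gamma (1 - \<alpha>) * ((v (a (s + 1)) - v (a s)) / \<tau> *
          (((t - a s) powr (1 - \<alpha>) - (t - a (s + 1)) powr (1 - \<alpha>)) / (1 - \<alpha>)))"
      by (simp add: a_def mult_ac)
  qed
  moreover have "E s = integral {a s..a (s + 1)} (\<lambda>x. v' x / (t - x) powr \<alpha>) -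
      (v (a (s + 1)) - v (a s)) / (a (s + 1) - a s) *
         (((t - a s) powr (1 - \<alpha>) - (t - a (s + 1)) powr (1 - \<alpha>)) / (1 - \<alpha>))" if "s \<le> j" for s
    unfolding E_def
    by (rule kernel_error_integral[OF \<alpha> lt[of s] a_le[of "s + 1"] cell_der[of s] cell_lip[of s]])
       (use that in auto)
  ultimately have "caputo \<alpha> v t - caputo_diff \<alpha> \<tau> v j = 1 / Gamma (1 - \<alpha>) * (\<Sum>s<Suc j. E s)"
    unfolding caputo by (simp add: sum_subtractf right_diff_distrib flip: lessThan_Suc_atMost)
  moreover have "0 < Gamma (1 - \<alpha>)"
    using \<alpha> by (intro Gamma_real_pos) auto
  ultimately have "\<bar>caputo \<alpha> v t - caputo_diff \<alpha> \<tau> v j\<bar> = \<bar>\<Sum>s<Suc j. E s\<bar> / Gamma (1 - \<alpha>)"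
    by (simp add: abs_mult abs_divide)
  also have "\<dots> \<le> M * (1 + 1 / (1 - \<alpha>)) * \<tau> powr (2 - \<alpha>) / Gamma (1 - \<alpha>)"
    using sumE \<open>0 < Gamma (1 - \<alpha>)\<close> by (intro divide_right_mono) auto
  finally show ?thesis by (simp add: t_def)
qed

section \<open>From smoothness to a Lipschitz derivative\<close>

text \<open>The second derivative is itself differentiable, hence continuous and bounded on the
  compact interval; its bound is the Lipschitz constant of the first.\<close>

lemma Ck_on_lipschitz_deriv:
  assumes "Ck_on 3 v {0..T}"
  obtains v' M where
    "\<And>x. x \<in> {0..T} \<Longrightarrow> (v has_real_derivative v' x) (at x within {0..T})"
    "\<And>x y. x \<in> {0..T} \<Longrightarrow> y \<in> {0..T} \<Longrightarrow> \<bar>v' x - v' y\<bar> \<le> M * \<bar>x - y\<bar>"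
proof -
  from assms obtain D where D0: "\<And>x. x \<in> {0..T} \<Longrightarrow> D 0 x = v x"
    and D: "\<And>i x. i < 3 \<Longrightarrow> x \<in> {0..T} \<Longrightarrow>
      (D i has_real_derivative D (Suc i) x) (at x within {0..T})"
    unfolding Ck_on_def by metis
  have "continuous_on {0..T} (D 2)"
    using D[of 2] DERIV_continuous by (fastforce simp: continuous_on_eq_continuous_within)
  then have "bounded (D 2 ` {0..T})"
    by (intro compact_imp_bounded compact_continuous_image) auto
  then obtain M where M: "\<And>x. x \<in> {0..T} \<Longrightarrow> norm (D 2 x) \<le> M"
    unfolding bounded_iff by blast
  show ?thesis
  proof (rule that)
    show "(v has_real_derivative D 1 x) (at x within {0..T})" if "x \<in> {0..T}" for x
    proof (rule has_field_derivative_transform_within[OF _ zero_less_one that])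
      show "(D 0 has_real_derivative D 1 x) (at x within {0..T})"
        using D[of 0 x] that by simp
    qed (rule D0)
    show "\<bar>D 1 x - D 1 y\<bar> \<le> M * \<bar>x - y\<bar>" if "x \<in> {0..T}" "y \<in> {0..T}" for x y
    proof -
      have "norm (D 1 x - D 1 y) \<le> M * norm (x - y)"
      proof (rule field_differentiable_bound[OF _ _ M])
        show "(D 1 has_real_derivative D 2 z) (at z within {0..T})" if "z \<in> {0..T}" for z
          using D[of 1 z] that by (simp add: numeral_2_eq_2)
      qed (use that in auto)
      then show ?thesis by simp
    qed
  qed
qed

theorem lemma1:
  fixes \<alpha> T :: real and v :: "real \<Rightarrow> real"
  assumes "0 < \<alpha>" and "\<alpha> < 1" and "0 < T"
    and "Ck_on 3 v {0..T}"
  shows "\<exists>C::real. \<forall>N::nat. N \<ge> 1 \<longrightarrow>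
           (\<forall>\<tau>. \<tau> = T / real N \<longrightarrow>
             (\<forall>j<N. \<bar>caputo \<alpha> v (grid \<tau> (j + 1)) - caputo_diff \<alpha> \<tau> v j\<bar>
                      \<le> C * \<tau> powr (2 - \<alpha>)))"
proof -
  obtain v' M where v':
    "\<And>x. x \<in> {0..T} \<Longrightarrow> (v has_real_derivative v' x) (at x within {0..T})"
    "\<And>x y. x \<in> {0..T} \<Longrightarrow> y \<in> {0..T} \<Longrightarrow> \<bar>v' x - v' y\<bar> \<le> M * \<bar>x - y\<bar>"
    using Ck_on_lipschitz_deriv[OF assms(4)] by blast
  show ?thesis
  \<comment> \<open>\<open>M\<close> was obtained from \<open>v\<close> and \<open>T\<close> alone,
    so this witness is independent of \<open>N\<close> and \<open>j\<close>.\<close>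
  proof (intro exI[of _ "M * (1 + 1 / (1 - \<alpha>)) / Gamma (1 - \<alpha>)"] allI impI)
    fix N j :: nat and \<tau> :: real
    assume N: "N \<ge> 1" and \<tau>: "\<tau> = T / real N" and j: "j < N"
    have "0 < \<tau>" using \<tau> N assms(3) by simp
    moreover have "grid \<tau> (j + 1) \<le> T"
    proof -
      have "real (j + 1) * \<tau> \<le> real N * \<tau>"
        using j \<open>0 < \<tau>\<close> by (intro mult_right_mono) auto
      then show ?thesis using \<tau> N by (simp add: grid_def)
    qed
    ultimately show "\<bar>caputo \<alpha> v (grid \<tau> (j + 1)) - caputo_diff \<alpha> \<tau> v j\<bar>
        \<le> M * (1 + 1 / (1 - \<alpha>)) / Gamma (1 - \<alpha>) * \<tau> powr (2 - \<alpha>)"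
      by (intro caputo_diff_error[OF assms(1,2) _ _ v']) auto
  qed
qed

end
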